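(* Let $(X,\tau)$ be a Hausdorff extended locally convex space having a countable neighborhood base at $0_X$, with finest locally convex topology $\tau_F$, and let $\|\cdot\|$ be a norm on $X$ such that the linear functionals on $X$ continuous with respect to $\|\cdot\|$ are exactly the $\tau$-continuous linear functionals, i.e. $(X,\|\cdot\|)^*=(X,\tau)^*$. Then $\tau_F$ is the topology induced by the norm $\|\cdot\|$.
   Context: An extended seminorm on a vector space $X$ over $\mathbb{R}$ or $\mathbb{C}$ is a map $\rho:X\to[0,\infty]$ with $\rho(\alpha x)=|\alpha|\rho(x)$ and $\rho(x+y)\le\rho(x)+\rho(y)$. An extended locally convex space $(X,\tau)$ is a vector space with the topology induced by a family $\{\rho_i\}$ of extended seminorms (neighborhood base at $x_0$: $\{x:\max_{i\in J}\rho_i(x-x_0)<\varepsilon\}$, $J$ finite, $\varepsilon>0$). A locally convex topology is one induced in this way by finite-valued seminorms. The finest locally convex topology of $(X,\tau)$ is the locally convex topology $\tau_F\subseteq\tau$ such that every locally convex topology $\sigma\subseteq\tau$ on $X$ satisfies $\sigma\subseteq\tau_F$. *)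

theory Defs
  imports "HOL-Analysis.Analysis"
begin

definition ext_seminorm :: "('k::real_normed_field \<Rightarrow> 'v::ab_group_add \<Rightarrow> 'v) \<Rightarrow> ('v \<Rightarrow> ennreal) \<Rightarrow> bool" where
  "ext_seminorm smul \<rho> \<longleftrightarrow>
     (\<forall>a x. \<rho> (smul a x) = ennreal (norm a) * \<rho> x) \<and> (\<forall>x y. \<rho> (x + y) \<le> \<rho> x + \<rho> y)"

definition finite_seminorm :: "('k::real_normed_field \<Rightarrow> 'v::ab_group_add \<Rightarrow> 'v) \<Rightarrow> ('v \<Rightarrow> ennreal) \<Rightarrow> bool" where
  "finite_seminorm smul \<rho> \<longleftrightarrow> ext_seminorm smul \<rho> \<and> (\<forall>x. \<rho> x < \<infinity>)"

definition seminorm_topology :: "('v::ab_group_add \<Rightarrow> ennreal) set \<Rightarrow> 'v topology" where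
  "seminorm_topology P = topology (\<lambda>U. \<forall>x0\<in>U. \<exists>J. J \<subseteq> P \<and> finite J \<and>
      (\<exists>\<epsilon>::real. \<epsilon> > 0 \<and> {x. \<forall>\<rho>\<in>J. \<rho> (x - x0) < ennreal \<epsilon>} \<subseteq> U))"

definition ext_lc_topology :: "('k::real_normed_field \<Rightarrow> 'v::ab_group_add \<Rightarrow> 'v) \<Rightarrow> 'v topology \<Rightarrow> bool" where
  "ext_lc_topology smul \<tau> \<longleftrightarrow> (\<exists>P. (\<forall>\<rho>\<in>P. ext_seminorm smul \<rho>) \<and> \<tau> = seminorm_topology P)"

definition lc_topology :: "('k::real_normed_field \<Rightarrow> 'v::ab_group_add \<Rightarrow> 'v) \<Rightarrow> 'v topology \<Rightarrow> bool" where
  "lc_topology smul \<sigma> \<longleftrightarrow> (\<exists>Q. (\<forall>\<rho>\<in>Q. finite_seminorm smul \<rho>) \<and> \<sigma> = seminorm_topology Q)"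

definition coarser :: "'v topology \<Rightarrow> 'v topology \<Rightarrow> bool" where
  "coarser \<sigma> \<tau> \<longleftrightarrow> (\<forall>U. openin \<sigma> U \<longrightarrow> openin \<tau> U)"

definition finest_lc_topology :: "('k::real_normed_field \<Rightarrow> 'v::ab_group_add \<Rightarrow> 'v) \<Rightarrow> 'v topology \<Rightarrow> 'v topology \<Rightarrow> bool" where
  "finest_lc_topology smul \<tau> \<tau>F \<longleftrightarrow> lc_topology smul \<tau>F \<and> coarser \<tau>F \<tau> \<and>
     (\<forall>\<sigma>. lc_topology smul \<sigma> \<and> coarser \<sigma> \<tau> \<longrightarrow> coarser \<sigma> \<tau>F)"

definition linear_functional :: "('k::real_normed_field \<Rightarrow> 'v::ab_group_add \<Rightarrow> 'v) \<Rightarrow> ('v \<Rightarrow> 'k) \<Rightarrow> bool" where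
  "linear_functional smul f \<longleftrightarrow> (\<forall>x y. f (x + y) = f x + f y) \<and> (\<forall>a x. f (smul a x) = a * f x)"

definition dual_space :: "('k::real_normed_field \<Rightarrow> 'v::ab_group_add \<Rightarrow> 'v) \<Rightarrow> 'v topology \<Rightarrow> ('v \<Rightarrow> 'k) set" where
  "dual_space smul \<tau> = {f. linear_functional smul f \<and> continuous_map \<tau> euclidean f}"

definition is_norm :: "('k::real_normed_field \<Rightarrow> 'v::ab_group_add \<Rightarrow> 'v) \<Rightarrow> ('v \<Rightarrow> real) \<Rightarrow> bool" where
  "is_norm smul N \<longleftrightarrow> (\<forall>x. N x \<ge> 0) \<and> (\<forall>x. N x = 0 \<longleftrightarrow> x = 0) \<and>
     (\<forall>a x. N (smul a x) = norm a * N x) \<and> (\<forall>x y. N (x + y) \<le> N x + N y)"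

definition norm_topology :: "('v::ab_group_add \<Rightarrow> real) \<Rightarrow> 'v topology" where
  "norm_topology N = seminorm_topology {\<lambda>x. ennreal (N x)}"

definition countable_nhds_base_at :: "'v topology \<Rightarrow> 'v \<Rightarrow> bool" where
  "countable_nhds_base_at \<tau> x0 \<longleftrightarrow> (\<exists>B. countable B \<and>
     (\<forall>V\<in>B. \<exists>W. openin \<tau> W \<and> x0 \<in> W \<and> W \<subseteq> V) \<and>
     (\<forall>U. openin \<tau> U \<and> x0 \<in> U \<longrightarrow> (\<exists>V\<in>B. V \<subseteq> U)))"

end

theory Submission
  imports Defs
begin

text \<open>Everything rests on one fact: if a seminorm \<open>p\<close> is unbounded on a set, then some linear functional dominated by a multiple of \<open>p\<close> is unbounded on that set (Hahn--Banach and a gliding hump). Applied to the norm along a sequence tending to zero in \<open>\<tau>\<close>, it shows that the norm is \<open>\<tau>\<close>-continuous; applied to a seminorm of \<open>\<tau>\<^sub>F\<close> on the unit ball, it shows that this seminorm is norm-continuous.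

Since the scalar field is only a \<open>real_normed_field\<close>, passing from real to scalar-valued functionals requires the Gelfand--Mazur theorem: such a field is \<open>\<real>\<close> or \<open>\<real>(i)\<close>.\<close>

section \<open>Real normed fields\<close>

text \<open>The hypotheses tie \<open>N\<close> to \<open>\<tau>\<close> only through linear
  functionals, so each comparison of topologies has to be reduced to the behaviour of a single
  functional. Deducing boundedness of a set from boundedness of every functional on it is usually
  done by Banach-Steinhaus in the complete dual. Here the gliding hump does it by hand: its partial
  sums converge pointwise in the reals with an error controlled by the seminorm, so no completeness
  of the space enters. The countable base condenses unboundedness on every neighbourhood of zero
  into one sequence; a \<open>\<tau>\<close>-continuous functional is small from some index on and
  hence bounded along it. Scalar-valued functionals come from a real one \<open>g\<close> by
  \<open>g x - j * g (j x)\<close>, which presupposes that every scalar is real or a real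
  combination of \<open>1\<close> and \<open>j\<close>. To obtain this without resolvents and
  Liouville's theorem, a formal root of -1 is adjoined, even if the field already has one; zero
  divisors may then appear, but only the multiplicativity of the form \<open>x^2 + y^2\<close> is
  used.\<close>

datatype 'a adjoin_i = Adjoin_i (re_part: 'a) (im_part: 'a)

instantiation adjoin_i :: (comm_ring_1) comm_ring_1
begin
definition "0 = Adjoin_i 0 0"
definition "1 = Adjoin_i 1 0"
definition "u + v = Adjoin_i (re_part u + re_part v) (im_part u + im_part v)"
definition "u - v = Adjoin_i (re_part u - re_part v) (im_part u - im_part v)"
definition "- u = Adjoin_i (- re_part u) (- im_part u)"
definition "u * v = Adjoin_i (re_part u * re_part v - im_part u * im_part v)
  (re_part u * im_part v + im_part u * re_part v)"
instance
  by standard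
    (auto simp: zero_adjoin_i_def one_adjoin_i_def plus_adjoin_i_def minus_adjoin_i_def
      uminus_adjoin_i_def times_adjoin_i_def algebra_simps adjoin_i.expand)
end

text \<open>\<open>x\<^sup>2 + y\<^sup>2 = (x + i y) (x - i y)\<close> makes \<open>adjoin_norm\<close> multiplicative. Pitfall: it vanishes at some nonzero elements if \<open>-1\<close> is a square in the field.\<close>
definition adjoin_norm :: "'a::real_normed_field adjoin_i \<Rightarrow> real" where
  "adjoin_norm u = norm ((re_part u)\<^sup>2 + (im_part u)\<^sup>2)"

text \<open>\<open>adjoin_norm\<close> is homogeneous of degree two and has no triangle inequality.
  This submultiplicative norm controls the cross term that arises when a complex number is
  subtracted.\<close>

definition adjoin_l1 :: "'a::real_normed_field adjoin_i \<Rightarrow> real" where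
  "adjoin_l1 u = norm (re_part u) + norm (im_part u)"

definition of_cpx :: "complex \<Rightarrow> 'a::real_normed_field adjoin_i" where
  "of_cpx z = Adjoin_i (of_real (Re z)) (of_real (Im z))"

lemma adjoin_norm_mult: "adjoin_norm (u * v) = adjoin_norm u * adjoin_norm v"
proof -
  have "(re_part (u * v))\<^sup>2 + (im_part (u * v))\<^sup>2 =
      ((re_part u)\<^sup>2 + (im_part u)\<^sup>2) * ((re_part v)\<^sup>2 + (im_part v)\<^sup>2)"
    by (simp add: times_adjoin_i_def power2_eq_square algebra_simps)
  then show ?thesis
    by (simp add: adjoin_norm_def norm_mult)
qed

lemma adjoin_norm_power: "adjoin_norm (u ^ n) = adjoin_norm u ^ n"
  by (induction n) (auto simp: adjoin_norm_mult, simp add: adjoin_norm_def one_adjoin_i_def)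

lemma adjoin_l1_mult: "adjoin_l1 (u * v) \<le> adjoin_l1 u * adjoin_l1 v"
proof -
  have "norm (re_part u * re_part v - im_part u * im_part v)
      \<le> norm (re_part u) * norm (re_part v) + norm (im_part u) * norm (im_part v)"
    by (metis norm_mult norm_triangle_ineq4)
  moreover have "norm (re_part u * im_part v + im_part u * re_part v)
      \<le> norm (re_part u) * norm (im_part v) + norm (im_part u) * norm (re_part v)"
    by (metis norm_mult norm_triangle_ineq)
  ultimately show ?thesis
    by (simp add: adjoin_l1_def times_adjoin_i_def algebra_simps)
qed

lemma adjoin_l1_nonneg: "0 \<le> adjoin_l1 u"
  by (simp add: adjoin_l1_def)

lemma adjoin_l1_power: "adjoin_l1 (u ^ n) \<le> adjoin_l1 u ^ n"
proof (induction n)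
  case 0
  then show ?case by (simp add: adjoin_l1_def one_adjoin_i_def)
next
  case (Suc n)
  have "adjoin_l1 (u ^ Suc n) \<le> adjoin_l1 u * adjoin_l1 (u ^ n)"
    using adjoin_l1_mult by simp
  also have "\<dots> \<le> adjoin_l1 u * adjoin_l1 u ^ n"
    using Suc adjoin_l1_nonneg mult_left_mono by blast
  finally show ?case by simp
qed

lemma of_cpx_add: "of_cpx (z + w) = of_cpx z + of_cpx w"
  by (simp add: of_cpx_def plus_adjoin_i_def)

lemma of_cpx_minus: "of_cpx (- z) = - of_cpx z"
  by (simp add: of_cpx_def uminus_adjoin_i_def)

lemma of_cpx_mult: "of_cpx (z * w) = of_cpx z * of_cpx w"
  by (simp add: of_cpx_def times_adjoin_i_def)

text \<open>Expanding the squares leaves the form of \<open>u\<close>, the real number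
  \<open>(cmod w)^2\<close> and a cross term linear in \<open>u\<close>; the ordinary triangle
  inequality of the field finishes.\<close>

lemma adjoin_norm_diff_of_cpx:
  fixes u :: "'a::real_normed_field adjoin_i"
  shows   "adjoin_norm (u - of_cpx w) \<le> adjoin_norm u + (cmod w)\<^sup>2 + 2 * cmod w * adjoin_l1 u"
proof -
  let ?x = "re_part u" and ?y = "im_part u"
  let ?s = "of_real (Re w) :: 'a" and ?t = "of_real (Im w) :: 'a"
  have eq: "(?x - ?s)\<^sup>2 + (?y - ?t)\<^sup>2 =
      (?x\<^sup>2 + ?y\<^sup>2) + of_real ((cmod w)\<^sup>2) - 2 * (?s * ?x + ?t * ?y)"
    unfolding cmod_power2 by (simp add: power2_eq_square algebra_simps)
  have "norm (?s * ?x + ?t * ?y) \<le> \<bar>Re w\<bar> * norm ?x + \<bar>Im w\<bar> * norm ?y"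
    by (rule order_trans [OF norm_triangle_ineq]) (simp add: norm_mult)
  also have "\<dots> \<le> cmod w * norm ?x + cmod w * norm ?y"
    by (intro add_mono mult_right_mono abs_Re_le_cmod abs_Im_le_cmod) auto
  finally have "norm (?s * ?x + ?t * ?y) \<le> cmod w * adjoin_l1 u"
    by (simp only: adjoin_l1_def distrib_left)
  moreover have "norm (2 * (?s * ?x + ?t * ?y)) = 2 * norm (?s * ?x + ?t * ?y)"
    by (simp only: norm_mult norm_numeral)
  ultimately have 1: "norm (2 * (?s * ?x + ?t * ?y)) \<le> 2 * cmod w * adjoin_l1 u"
    by simp
  have 2: "norm (of_real ((cmod w)\<^sup>2) :: 'a) = (cmod w)\<^sup>2"
    by (metis abs_power2 norm_of_real)
  have "norm ((?x - ?s)\<^sup>2 + (?y - ?t)\<^sup>2)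
      \<le> norm (?x\<^sup>2 + ?y\<^sup>2) + (cmod w)\<^sup>2 + norm (2 * (?s * ?x + ?t * ?y))"
    unfolding eq using 2 by (smt (verit) norm_triangle_ineq norm_triangle_ineq4)
  with 1 show ?thesis
    by (simp add: adjoin_norm_def of_cpx_def minus_adjoin_i_def)
qed

lemma exists_power_eq_minus_one: "\<exists>z::complex. z ^ (2 ^ k) = -1"
proof (induction k)
  case (Suc k)
  then obtain z :: complex where "z ^ (2 ^ k) = -1" by blast
  then have "(csqrt z) ^ (2 ^ Suc k) = -1"
    by (simp add: power_mult)
  then show ?case by blast
qed simp

text \<open>Factoring \<open>B\<^sup>2\<^sup>n - w\<^sup>2\<^sup>n = (B\<^sup>n - w\<^sup>n) (B\<^sup>n - (\<zeta> w)\<^sup>n)\<close> with \<open>\<zeta>\<^sup>n = -1\<close> avoids products over all roots of unity.\<close>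
lemma adjoin_norm_power_diff_ge:
  assumes min: "\<And>w. m \<le> adjoin_norm (B - of_cpx w)" and "0 < m"
  shows "adjoin_norm (B - of_cpx w) * m ^ (2 ^ k - 1) \<le> adjoin_norm (B ^ (2 ^ k) - of_cpx (w ^ (2 ^ k)))"
proof (induction k arbitrary: w)
  case (Suc k)
  let ?n = "2 ^ k :: nat"
  obtain z :: complex where z: "z ^ ?n = -1"
    using exists_power_eq_minus_one by blast
  have n: "?n - 1 + 1 = ?n" "2 ^ Suc k - 1 = ?n - 1 + ?n"
    by auto
  \<comment> \<open>The plus factor is the minus factor at the rotated point \<open>z * w\<close>.
    The induction hypothesis there, with \<open>min\<close> for its first factor, bounds it below by
    \<open>m ^ ?n\<close>; this is why \<open>w\<close> is arbitrary in the induction.\<close>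
  have "m ^ ?n = m * m ^ (?n - 1)"
    by (metis n(1) Suc_eq_plus1 power_Suc)
  also have "\<dots> \<le> adjoin_norm (B - of_cpx (z * w)) * m ^ (?n - 1)"
    using min \<open>0 < m\<close> by (intro mult_right_mono) auto
  also have "\<dots> \<le> adjoin_norm (B ^ ?n - of_cpx ((z * w) ^ ?n))"
    by (rule Suc)
  also have "B ^ ?n - of_cpx ((z * w) ^ ?n) = B ^ ?n + of_cpx (w ^ ?n)"
    using z by (simp add: power_mult_distrib of_cpx_minus)
  finally have ge: "m ^ ?n \<le> adjoin_norm (B ^ ?n + of_cpx (w ^ ?n))" .
  have sq: "B ^ (2 ^ Suc k) = B ^ ?n * B ^ ?n" "w ^ (2 ^ Suc k) = w ^ ?n * w ^ ?n"
    by (simp_all add: power_add [symmetric] mult_2)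
  have "adjoin_norm (B - of_cpx w) * m ^ (2 ^ Suc k - 1)
      = (adjoin_norm (B - of_cpx w) * m ^ (?n - 1)) * m ^ ?n"
    unfolding n(2) power_add by simp
  also have "\<dots> \<le> adjoin_norm (B ^ ?n - of_cpx (w ^ ?n)) * adjoin_norm (B ^ ?n + of_cpx (w ^ ?n))"
    using Suc ge \<open>0 < m\<close> by (intro mult_mono) (auto simp: adjoin_norm_def)
  also have "\<dots> = adjoin_norm (B ^ (2 ^ Suc k) - of_cpx (w ^ (2 ^ Suc k)))"
    unfolding adjoin_norm_mult [symmetric] sq of_cpx_mult
    by (rule arg_cong [where f = adjoin_norm]) (simp add: algebra_simps)
  finally show ?case .
qed simp

text \<open>With \<open>n = 2 ^ k\<close>, the value at \<open>w\<close> divided by the minimum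
  \<open>m\<close> is at most \<open>adjoin_norm (B ^ n - of_cpx (w ^ n)) / m ^ n\<close>. Expanding
  the numerator gives \<open>1\<close> plus two terms that decay geometrically in \<open>n\<close>
  when \<open>w\<close> is small, so the quotient is at most \<open>1\<close>.\<close>

lemma adjoin_norm_eq_min_nearby:
  fixes B :: "'a::real_normed_field adjoin_i"
  assumes min: "\<And>w. adjoin_norm B \<le> adjoin_norm (B - of_cpx w)" and pos: "0 < adjoin_norm B"
  shows "\<exists>r>0. \<forall>w. cmod w < r \<longrightarrow> adjoin_norm (B - of_cpx w) = adjoin_norm B"
proof -
  define m where "m = adjoin_norm B"
  define L where "L = adjoin_l1 B"
  \<comment> \<open>The two bounds make the ratios \<open>\<alpha>\<close> and
    \<open>\<beta>\<close> below smaller than one; \<open>L + 1\<close> keeps the denominator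
    positive.\<close>
  define r where "r = min (sqrt m) (m / (L + 1))"
  have "0 < m" using pos by (simp add: m_def)
  have "0 \<le> L" by (simp add: L_def adjoin_l1_nonneg)
  have "0 < r" using \<open>0 < m\<close> \<open>0 \<le> L\<close> by (simp add: r_def)
  moreover have "adjoin_norm (B - of_cpx w) = m" if w: "cmod w < r" for w
  proof -
    define \<alpha> where "\<alpha> = (cmod w)\<^sup>2 / m"
    define \<beta> where "\<beta> = cmod w * L / m"
    have "cmod w < sqrt m" using w by (simp add: r_def)
    then have "(cmod w)\<^sup>2 < m"
      by (metis \<open>0 < m\<close> norm_ge_zero order_less_imp_le power_strict_mono real_sqrt_pow2 zero_less_numeral)
    then have \<alpha>: "0 \<le> \<alpha>" "\<alpha> < 1"
      using \<open>0 < m\<close> by (auto simp: \<alpha>_def)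
    have "cmod w * (L + 1) < m"
      using w \<open>0 \<le> L\<close> by (simp add: r_def field_simps)
    then have "cmod w * L < m"
      by (smt (verit) mult_left_mono norm_ge_zero)
    then have \<beta>: "0 \<le> \<beta>" "\<beta> < 1"
      using \<open>0 < m\<close> \<open>0 \<le> L\<close> by (auto simp: \<beta>_def)
    have cancel: "x / m * m ^ n = x * m ^ (n - 1)" if "0 < n" for x and n :: nat
      using that \<open>0 < m\<close> by (cases n) auto
    have bound: "adjoin_norm (B - of_cpx w) / m \<le> 1 + \<alpha> ^ (2 ^ k) + 2 * \<beta> ^ (2 ^ k)" for k
    proof -
      let ?n = "2 ^ k :: nat"
      have "adjoin_norm (B - of_cpx w) / m * m ^ ?n = adjoin_norm (B - of_cpx w) * m ^ (?n - 1)"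
        by (rule cancel) simp
      also have "\<dots> \<le> adjoin_norm (B ^ ?n - of_cpx (w ^ ?n))"
        using min \<open>0 < m\<close> by (intro adjoin_norm_power_diff_ge) (auto simp: m_def)
      also have "\<dots> \<le> adjoin_norm (B ^ ?n) + (cmod (w ^ ?n))\<^sup>2 + 2 * cmod (w ^ ?n) * adjoin_l1 (B ^ ?n)"
        by (rule adjoin_norm_diff_of_cpx)
      also have "\<dots> \<le> m ^ ?n + (cmod (w ^ ?n))\<^sup>2 + 2 * cmod (w ^ ?n) * L ^ ?n"
        by (intro add_mono mult_left_mono) (auto simp: adjoin_norm_power m_def L_def adjoin_l1_power)
      also have "\<dots> = (1 + \<alpha> ^ ?n + 2 * \<beta> ^ ?n) * m ^ ?n"
      proof -
        have "\<alpha> ^ ?n * m ^ ?n = (cmod (w ^ ?n))\<^sup>2" "\<beta> ^ ?n * m ^ ?n = cmod (w ^ ?n) * L ^ ?n"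
          unfolding power_mult_distrib [symmetric] using \<open>0 < m\<close>
          by (simp_all add: \<alpha>_def \<beta>_def norm_power power_mult_distrib)
            (simp flip: power_mult add: mult.commute)
        then show ?thesis by (simp add: distrib_right)
      qed
      finally show ?thesis
        by (rule mult_right_le_imp_le) (simp add: \<open>0 < m\<close>)
    qed
    have sub: "strict_mono (\<lambda>k. 2 ^ k :: nat)"
      by (simp add: strict_mono_def)
    have "(\<lambda>k. 1 + \<alpha> ^ (2 ^ k) + 2 * \<beta> ^ (2 ^ k)) \<longlonglongrightarrow> 1 + 0 + 2 * 0"
      using LIMSEQ_subseq_LIMSEQ [OF LIMSEQ_realpow_zero sub, OF \<alpha>]
        LIMSEQ_subseq_LIMSEQ [OF LIMSEQ_realpow_zero sub, OF \<beta>]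
      by (intro tendsto_add tendsto_mult tendsto_const) (auto simp: o_def)
    then have "adjoin_norm (B - of_cpx w) / m \<le> 1"
      using bound LIMSEQ_le_const by (metis (no_types, lifting) add.right_neutral mult_zero_right)
    then have "adjoin_norm (B - of_cpx w) \<le> m"
      using \<open>0 < m\<close> by simp
    with min [of w] show ?thesis by (simp add: m_def)
  qed
  ultimately show ?thesis unfolding m_def by blast
qed

text \<open>The function \<open>z \<mapsto> \<bar>(a - Re z)\<^sup>2 + (Im z)\<^sup>2\<bar>\<close> on the complex plane attains its minimum; a positive minimum would be attained on a nonempty open and closed set.\<close>
lemma real_normed_field_quadratic_root:
  fixes a :: "'a::real_normed_field"
  shows "\<exists>s t::real. (a - of_real s)\<^sup>2 + (of_real t)\<^sup>2 = 0"
proof -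
  define A where "A = Adjoin_i a 0"
  define \<phi> where "\<phi> z = adjoin_norm (A - of_cpx z)" for z
  \<comment> \<open>Large enough that \<open>\<phi>\<close> exceeds
    \<open>\<phi> 0 = (norm a)^2\<close> from this radius on: there
    \<open>cmod z * (cmod z - 2 * norm a) > 2 * (norm a)^2\<close>. Hence a minimum over the disc is
    global.\<close>
  define R where "R = 3 * norm a + 1"
  have \<phi>: "\<phi> z = norm ((a - of_real (Re z))\<^sup>2 + (of_real (Im z))\<^sup>2)" for z
    by (simp add: \<phi>_def A_def adjoin_norm_def of_cpx_def minus_adjoin_i_def)
  have cont: "continuous_on UNIV \<phi>"
    unfolding \<phi> by (intro continuous_intros)
  have far: "\<phi> 0 < \<phi> z" if "R \<le> cmod z" for z
  proof -
    have eq: "(of_real ((cmod z)\<^sup>2) :: 'a) = ((a - of_real (Re z))\<^sup>2 + (of_real (Im z))\<^sup>2)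
        + 2 * of_real (Re z) * a - a\<^sup>2"
      unfolding cmod_power2 by (simp add: power2_eq_square algebra_simps)
    have "(cmod z)\<^sup>2 = norm (of_real ((cmod z)\<^sup>2) :: 'a)"
      by (metis abs_power2 norm_of_real)
    also have "\<dots> \<le> \<phi> z + norm (2 * of_real (Re z) * a) + norm (a\<^sup>2)"
      unfolding eq \<phi> by (smt (verit) norm_triangle_ineq norm_triangle_ineq4)
    also have "\<dots> = \<phi> z + 2 * \<bar>Re z\<bar> * norm a + (norm a)\<^sup>2"
      by (simp add: norm_mult norm_power)
    also have "\<dots> \<le> \<phi> z + 2 * cmod z * norm a + (norm a)\<^sup>2"
      by (intro add_mono mult_right_mono mult_left_mono abs_Re_le_cmod) auto
    finally have 1: "cmod z * (cmod z - 2 * norm a) - (norm a)\<^sup>2 \<le> \<phi> z"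
      by (simp add: power2_eq_square algebra_simps)
    have "(3 * norm a + 1) * (norm a + 1) \<le> cmod z * (cmod z - 2 * norm a)"
      using that by (intro mult_mono) (auto simp: R_def)
    moreover have "(3 * norm a + 1) * (norm a + 1) = 2 * (norm a)\<^sup>2 + ((norm a)\<^sup>2 + 4 * norm a + 1)"
      by (simp add: power2_eq_square algebra_simps)
    moreover have "0 < (norm a)\<^sup>2 + 4 * norm a + 1"
      by (simp add: add_nonneg_pos)
    ultimately have "2 * (norm a)\<^sup>2 < cmod z * (cmod z - 2 * norm a)"
      by linarith
    with 1 have "(norm a)\<^sup>2 < \<phi> z" by linarith
    then show ?thesis by (simp add: \<phi> norm_power)
  qed
  have "R > 0" by (simp add: R_def add_nonneg_pos)
  obtain z0 where z0: "z0 \<in> cball 0 R" "\<And>z. z \<in> cball 0 R \<Longrightarrow> \<phi> z0 \<le> \<phi> z"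
    using continuous_attains_inf [of "cball 0 R" \<phi>] cont \<open>R > 0\<close>
    by (metis cball_eq_empty compact_cball continuous_on_subset linorder_not_less order_less_imp_not_less subset_UNIV)
  have min: "\<phi> z0 \<le> \<phi> z" for z
    using z0(2) [of z] z0(2) [of 0] far [of z] \<open>R > 0\<close> by fastforce
  have "\<phi> z0 = 0"
  proof (rule ccontr)
    assume "\<phi> z0 \<noteq> 0"
    then have pos: "0 < \<phi> z0" by (simp add: \<phi>)
    let ?S = "{z. \<phi> z = \<phi> z0}"
    have "closed ?S"
      using cont by (intro closed_Collect_eq) auto
    moreover have "open ?S"
      unfolding open_dist
    proof
      fix z1 assume "z1 \<in> ?S"
      then have z1: "adjoin_norm (A - of_cpx z1) = \<phi> z0"
        by (simp add: \<phi>_def)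
      have shift: "A - of_cpx z1 - of_cpx w = A - of_cpx (z1 + w)" for w
        by (simp add: of_cpx_add)
      obtain r where "r > 0"
        and r: "\<And>w. cmod w < r \<Longrightarrow> adjoin_norm (A - of_cpx z1 - of_cpx w) = \<phi> z0"
        using adjoin_norm_eq_min_nearby [of "A - of_cpx z1"] pos z1 min unfolding shift \<phi>_def
        by metis
      have "\<phi> z = \<phi> z0" if "dist z z1 < r" for z
        using r [of "z - z1"] that unfolding shift by (simp add: \<phi>_def dist_norm)
      with \<open>r > 0\<close> show "\<exists>e>0. \<forall>y. dist y z1 < e \<longrightarrow> y \<in> ?S" by blast
    qed
    ultimately have "?S = {} \<or> ?S = UNIV"
      by (simp only: flip: clopen)
    moreover have "z0 \<in> ?S" by simp
    ultimately have "?S = UNIV" by (metis empty_iff)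
    then have "\<phi> z = \<phi> z0" for z
      by (metis UNIV_I mem_Collect_eq)
    then have "\<phi> (of_real R) = \<phi> 0"
      by metis
    with far [of "of_real R"] \<open>R > 0\<close> show False by simp
  qed
  then show ?thesis unfolding \<phi> by auto
qed

text \<open>A non-real \<open>b\<close> satisfies \<open>(b - s)^2 = - t^2\<close> with
  \<open>t\<close> nonzero, and rescaling gives \<open>j\<close>. For any other \<open>a\<close> the
  same equation reads \<open>(a - s)^2 = (t * j)^2\<close>, and in a field equal squares differ only
  by sign.\<close>

lemma real_normed_field_cases:
  obtains "\<And>a::'a::real_normed_field. \<exists>r. a = of_real r"
  | j :: "'a::real_normed_field" where "j\<^sup>2 = - 1" "\<And>a. \<exists>s t. a = of_real s + of_real t * j"
proof (cases "\<forall>a::'a. \<exists>r. a = of_real r")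
  case True
  then show ?thesis using that(1) by blast
next
  case False
  then obtain b :: 'a where b: "\<And>r. b \<noteq> of_real r" by blast
  obtain s t where st: "(b - of_real s)\<^sup>2 + (of_real t)\<^sup>2 = 0"
    using real_normed_field_quadratic_root by blast
  define j where "j = (b - of_real s) / of_real t"
  have "t \<noteq> 0"
    using st b [of s] by auto
  then have j: "j\<^sup>2 = - 1"
    using st by (simp add: j_def power_divide divide_eq_minus_1_iff add_eq_0_iff2)
  have "\<exists>s t. a = of_real s + of_real t * j" for a
  proof -
    obtain s t where "(a - of_real s)\<^sup>2 + (of_real t)\<^sup>2 = 0"
      using real_normed_field_quadratic_root by blast
    then have "(a - of_real s)\<^sup>2 = (of_real t * j)\<^sup>2"
      by (simp add: power_mult_distrib j eq_neg_iff_add_eq_0)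
    then have "a - of_real s = of_real t * j \<or> a - of_real s = - (of_real t * j)"
      using power2_eq_iff by blast
    then have "a = of_real s + of_real t * j \<or> a = of_real s + of_real (- t) * j"
      by (auto simp: algebra_simps)
    then show ?thesis by blast
  qed
  with j show ?thesis using that(2) by blast
qed

section \<open>Functionals unbounded where a seminorm is unbounded\<close>

definition sublinear :: "(real \<Rightarrow> 'v::ab_group_add \<Rightarrow> 'v) \<Rightarrow> ('v \<Rightarrow> real) \<Rightarrow> bool" where
  "sublinear s q \<longleftrightarrow> (\<forall>x y. q (x + y) \<le> q x + q y) \<and> (\<forall>r x. 0 \<le> r \<longrightarrow> q (s r x) = r * q x)"

lemma sublinear_zero:
  assumes "vector_space s" and "sublinear s q"
  shows "q 0 = 0"
proof -
  interpret vector_space s by fact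
  have "q (s 0 0) = 0 * q 0"
    using assms(2) unfolding sublinear_def by blast
  then show ?thesis by simp
qed

lemma sublinear_ge:
  assumes "vector_space s" and "sublinear s q"
  shows "- q (- x) \<le> q x"
proof -
  have "q 0 \<le> q x + q (- x)"
    using assms(2) unfolding sublinear_def by (metis add.right_inverse)
  with sublinear_zero [OF assms] show ?thesis by linarith
qed

text \<open>Shared by two infima: over the lower bounds used for tightening and over the chains in
  Zorn's lemma. In the first, a single \<open>F i\<close> need not be sublinear, so the inequalities
  may move to another index \<open>k\<close>.\<close>

lemma sublinear_INF:
  fixes F :: "'i \<Rightarrow> 'v::ab_group_add \<Rightarrow> real"
  assumes vs: "vector_space s" and "I \<noteq> {}"
    and bdd: "\<And>x. bdd_below ((\<lambda>i. F i x) ` I)"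
    and add: "\<And>i j x y. i \<in> I \<Longrightarrow> j \<in> I \<Longrightarrow> \<exists>k\<in>I. F k (x + y) \<le> F i x + F j y"
    and scale: "\<And>i r x. i \<in> I \<Longrightarrow> 0 < r \<Longrightarrow> \<exists>k\<in>I. F k (s r x) \<le> r * F i x"
    and zero: "\<And>i. i \<in> I \<Longrightarrow> F i 0 = 0"
  shows "sublinear s (\<lambda>x. INF i\<in>I. F i x)"
  unfolding sublinear_def
proof (intro conjI allI impI)
  interpret vector_space s by fact
  let ?q = "\<lambda>x. INF i\<in>I. F i x"
  have le: "?q x \<le> F i x" if "i \<in> I" for i x
    using bdd that by (intro cINF_lower)
  show "?q (x + y) \<le> ?q x + ?q y" for x y
  proof -
    have 1: "?q (x + y) - F i x \<le> F j y" if ij: "i \<in> I" "j \<in> I" for i j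
    proof -
      obtain k where "k \<in> I" and "F k (x + y) \<le> F i x + F j y"
        using add [OF ij] by blast
      with le [of k "x + y"] show ?thesis by linarith
    qed
    have "?q (x + y) - F i x \<le> ?q y" if "i \<in> I" for i
      using 1 [OF that] \<open>I \<noteq> {}\<close> by (intro cINF_greatest)
    then have "?q (x + y) - ?q y \<le> F i x" if "i \<in> I" for i
      using that by fastforce
    then have "?q (x + y) - ?q y \<le> ?q x"
      using \<open>I \<noteq> {}\<close> by (intro cINF_greatest)
    then show ?thesis by simp
  qed
  \<comment> \<open>This inequality suffices: applied to \<open>1 / r\<close> and
    \<open>s r x\<close> it yields its own converse.\<close>
  have half: "?q (s r x) \<le> r * ?q x" if "0 < r" for r x
  proof -
    have "?q (s r x) / r \<le> F i x" if "i \<in> I" for i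
    proof -
      obtain k where "k \<in> I" "F k (s r x) \<le> r * F i x"
        using scale [OF \<open>i \<in> I\<close> \<open>0 < r\<close>] by blast
      then have "?q (s r x) \<le> r * F i x"
        using le order_trans by blast
      with \<open>0 < r\<close> show ?thesis by (simp add: field_simps)
    qed
    then have "?q (s r x) / r \<le> ?q x"
      using \<open>I \<noteq> {}\<close> by (intro cINF_greatest)
    with \<open>0 < r\<close> show ?thesis by (simp add: field_simps)
  qed
  show "?q (s r x) = r * ?q x" if "0 \<le> r" for r x
  proof (cases "r = 0")
    case True
    then show ?thesis using zero \<open>I \<noteq> {}\<close> by simp
  next
    case False
    with that have "0 < r" by simp
    have "?q x \<le> (1 / r) * ?q (s r x)"
      using half [of "1 / r" "s r x"] \<open>0 < r\<close> by simp
    with half [OF \<open>0 < r\<close>, of x] \<open>0 < r\<close> show ?thesis by (simp add: field_simps)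
  qed
qed

text \<open>The witness is the largest sublinear functional below \<open>q\<close> whose value at \<open>- y\<close> is at most \<open>- q y\<close>.\<close>
lemma sublinear_tighten:
  assumes vs: "vector_space s" and q: "sublinear s q"
  obtains q' where "sublinear s q'" and "q' \<le> q" and "q' (- y) \<le> - q y"
proof -
  interpret vector_space s by fact
  have sub: "q (x + z) \<le> q x + q z" and hom: "0 \<le> r \<Longrightarrow> q (s r x) = r * q x" for x z r
    using q by (auto simp: sublinear_def)
  \<comment> \<open>A sublinear \<open>q' \<le> q\<close> with \<open>q' (- y) \<le> - q y\<close>
    satisfies \<open>q' x \<le> q' (x + s t y) + t * q' (- y) \<le> F t x\<close> for
    \<open>t \<ge> 0\<close>. The infimum of these forced bounds is therefore the candidate.\<close>
  define F where "F t x = q (x + s t y) - t * q y" for t x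
  let ?q' = "\<lambda>x. INF t\<in>{0..}. F t x"
  have bdd: "bdd_below ((\<lambda>t. F t x) ` {0..})" for x
  proof (rule bdd_belowI2)
    fix t :: real assume "t \<in> {0..}"
    then show "- q (- x) \<le> F t x"
      using sub [of "x + s t y" "- x"] hom [of t y] by (simp add: F_def)
  qed
  have "sublinear s ?q'"
  proof (rule sublinear_INF [OF vs _ bdd])
    fix t u :: real and x z assume "t \<in> {0..}" "u \<in> {0..}"
    have "F (t + u) (x + z) \<le> F t x + F u z"
      using sub [of "x + s t y" "z + s u y"]
      by (simp add: F_def scale_left_distrib algebra_simps)
    then show "\<exists>k\<in>{0..}. F k (x + z) \<le> F t x + F u z"
      using \<open>t \<in> {0..}\<close> \<open>u \<in> {0..}\<close> by (intro bexI [of _ "t + u"]) auto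
  next
    fix t r :: real and x assume "t \<in> {0..}" "0 < r"
    have "F (r * t) (s r x) = r * F t x"
      using \<open>0 < r\<close> hom [of r "x + s t y"]
      by (simp add: F_def scale_right_distrib algebra_simps)
    then show "\<exists>k\<in>{0..}. F k (s r x) \<le> r * F t x"
      using \<open>t \<in> {0..}\<close> \<open>0 < r\<close> by (intro bexI [of _ "r * t"]) auto
  qed (auto simp: F_def hom)
  moreover have "?q' \<le> q"
  proof (rule le_funI)
    fix x
    have "?q' x \<le> F 0 x" using bdd by (intro cINF_lower) auto
    then show "?q' x \<le> q x" by (simp add: F_def)
  qed
  moreover have "?q' (- y) \<le> - q y"
  proof -
    have "?q' (- y) \<le> F 1 (- y)" using bdd by (intro cINF_lower) auto
    then show ?thesis using sublinear_zero [OF vs q] by (simp add: F_def)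
  qed
  ultimately show thesis by (rule that)
qed

text \<open>Zorn's lemma with pointwise infima as lower bounds of chains. They are finite because
  every sublinear functional below \<open>p\<close> is at least \<open>- p (- x)\<close> at
  \<open>x\<close>, and subadditive because of two members of a chain the smaller serves both
  summands.\<close>

lemma minimal_sublinear_exists:
  assumes vs: "vector_space s" and p: "sublinear s p"
  obtains g where "sublinear s g" and "g \<le> p" and "\<And>q. sublinear s q \<Longrightarrow> q \<le> g \<Longrightarrow> q = g"
proof -
  define A where "A = {q. sublinear s q \<and> q \<le> p}"
  have "\<exists>m\<in>A. \<forall>a\<in>A. a \<le> m \<longrightarrow> a = m"
  \<comment> \<open>The order is reversed, since the rule delivers maximal elements.\<close>
  proof (rule predicate_Zorn)
    show "partial_order_on A (relation_of (\<lambda>a b. b \<le> a) A)"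
      by (rule partial_order_on_relation_ofI) auto
  next
    fix C assume C: "C \<in> Chains (relation_of (\<lambda>a b. b \<le> a) A)"
    then have chain: "a \<le> b \<or> b \<le> a" if "a \<in> C" "b \<in> C" for a b
      using that by (auto simp: Chains_def relation_of_def)
    show "\<exists>u\<in>A. \<forall>a\<in>C. u \<le> a"
    proof (cases "C = {}")
      case True
      then show ?thesis using p by (auto simp: A_def)
    next
      case False
      have CA: "C \<subseteq> A"
        using C by (auto simp: Chains_def relation_of_def)
      have C_sub: "sublinear s a" "a \<le> p" if "a \<in> C" for a
        using CA that by (auto simp: A_def)
      have bdd: "bdd_below ((\<lambda>a. a x) ` C)" for x
      proof (rule bdd_belowI2)
        fix a assume "a \<in> C"
        then show "- p (- x) \<le> a x"
          using sublinear_ge [OF vs C_sub(1), of a x] C_sub(2) [of a] by (smt (verit) le_fun_def)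
      qed
      have "sublinear s (\<lambda>x. INF a\<in>C. a x)"
      proof (rule sublinear_INF [OF vs False bdd])
        fix a b x y assume ab: "a \<in> C" "b \<in> C"
        then consider "a \<le> b" | "b \<le> a" using chain by blast
        then show "\<exists>c\<in>C. c (x + y) \<le> a x + b y"
        proof cases
          case 1
          have "a (x + y) \<le> a x + a y" using C_sub(1) ab by (simp add: sublinear_def)
          also have "\<dots> \<le> a x + b y" using 1 by (simp add: le_fun_def)
          finally show ?thesis using ab by blast
        next
          case 2
          have "b (x + y) \<le> b x + b y" using C_sub(1) ab by (simp add: sublinear_def)
          also have "\<dots> \<le> a x + b y" using 2 by (simp add: le_fun_def)
          finally show ?thesis using ab by blast
        qed
      next
        fix a x and r :: real assume "a \<in> C" "0 < r"
        then show "\<exists>c\<in>C. c (s r x) \<le> r * a x"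
          using C_sub(1) [of a] by (intro bexI [of _ a]) (auto simp: sublinear_def)
      qed (use C_sub sublinear_zero [OF vs] in blast)
      moreover have le: "(\<lambda>x. INF a\<in>C. a x) \<le> a" if "a \<in> C" for a
        using bdd that by (auto simp: le_fun_def intro: cINF_lower)
      moreover have "(\<lambda>x. INF a\<in>C. a x) \<le> p"
        using le C_sub(2) False order_trans by blast
      ultimately show ?thesis unfolding A_def by blast
    qed
  qed
  then obtain g where "g \<in> A" and "\<And>a. a \<in> A \<Longrightarrow> a \<le> g \<Longrightarrow> a = g" by blast
  then show thesis
    by (intro that [of g]) (auto simp: A_def intro: order_trans)
qed

text \<open>A minimal sublinear functional is odd, since tightening it at \<open>y\<close> cannot change it; hence it is linear.\<close>
lemma hahn_banach_real:
  fixes s :: "real \<Rightarrow> 'v::ab_group_add \<Rightarrow> 'v"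
  assumes vs: "vector_space s" and p: "sublinear s p"
  obtains g where "\<And>x y. g (x + y) = g x + g y" and "\<And>r x. g (s r x) = r * g x"
    and "\<And>x. g x \<le> p x" and "g x0 = p x0"
proof -
  interpret vector_space s by fact
  \<comment> \<open>Tightening at \<open>x0\<close> before minimising survives in every smaller
    functional: \<open>g (- x0) \<le> - p x0\<close>, which for odd \<open>g\<close> forces
    \<open>g x0 = p x0\<close>.\<close>
  obtain p' where p': "sublinear s p'" "p' \<le> p" "p' (- x0) \<le> - p x0"
    using sublinear_tighten [OF vs p] by blast
  obtain g where g: "sublinear s g" "g \<le> p'"
    and min: "\<And>q. sublinear s q \<Longrightarrow> q \<le> g \<Longrightarrow> q = g"
    using minimal_sublinear_exists [OF vs p'(1)] by blast
  have odd: "g (- y) = - g y" for y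
  proof -
    obtain q' where "sublinear s q'" "q' \<le> g" "q' (- y) \<le> - g y"
      using sublinear_tighten [OF vs g(1)] by blast
    then have "g (- y) \<le> - g y" using min by metis
    with sublinear_ge [OF vs g(1), of y] show ?thesis by linarith
  qed
  have sub: "g (x + y) \<le> g x + g y" and hom: "0 \<le> r \<Longrightarrow> g (s r x) = r * g x" for x y r
    using g(1) by (auto simp: sublinear_def)
  show thesis
  proof (rule that)
    show "g (x + y) = g x + g y" for x y
      using sub [of x y] sub [of "- x" "- y"] odd [of "x + y"] odd [of x] odd [of y] by simp
    show "g (s r x) = r * g x" for r x
      using hom [of r x] hom [of "- r" x] odd [of "s r x"] by (cases "0 \<le> r") auto
    show le: "g x \<le> p x" for x
      using g(2) p'(2) by (meson le_funD order_trans)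
    have "g (- x0) \<le> - p x0"
      using g(2) p'(3) by (meson le_funD order_trans)
    with le [of x0] odd [of x0] show "g x0 = p x0" by simp
  qed
qed

text \<open>Gliding hump: the partial sums \<open>F n\<close> of \<open>\<Sum>\<plusminus>4\<^sup>-\<^sup>j h\<^sub>j\<close>, with signs chosen so that the \<open>j\<close>-th term adds to the modulus at \<open>a j\<close>.\<close>
lemma unbounded_linear_functional_real:
  fixes s :: "real \<Rightarrow> 'v::ab_group_add \<Rightarrow> 'v"
  assumes vs: "vector_space s"
    and add: "\<And>x y. p (x + y) \<le> p x + p y" and hom: "\<And>r x. p (s r x) = \<bar>r\<bar> * p x"
    and unbdd: "\<And>K. \<exists>a\<in>A. K < p a"
  obtains g where "\<And>x y. g (x + y) = g x + g y" and "\<And>r x. g (s r x) = r * g x"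
    and "\<And>x. \<bar>g x\<bar> \<le> 2 * p x" and "\<And>K. \<exists>a\<in>A. K < \<bar>g a\<bar>"
proof -
  interpret vector_space s by fact
  have p: "sublinear s p" using add hom by (simp add: sublinear_def)
  have even: "p (- x) = p x" for x using hom [of "- 1" x] by simp
  have p_nonneg: "0 \<le> p x" for x
    using sublinear_ge [OF vs p, of x] even by simp
  \<comment> \<open>The factor \<open>4 ^ j\<close> compensates the weight of the
    \<open>j\<close>-th term, which thus still exceeds \<open>j\<close> in modulus at
    \<open>a j\<close>.\<close>
  have "\<exists>a\<in>A. real j * 4 ^ j < p a" for j using unbdd by blast
  then obtain a where a: "a j \<in> A" "real j * 4 ^ j < p (a j)" for j by metis
  have "\<exists>h. (\<forall>x y. h (x + y) = h x + h y) \<and> (\<forall>r x. h (s r x) = r * h x) \<and>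
      (\<forall>x. \<bar>h x\<bar> \<le> p x) \<and> h (a j) = p (a j)" for j
  proof -
    obtain h where h: "\<And>x y. h (x + y) = h x + h y" "\<And>r x. h (s r x) = r * h x"
      "\<And>x. h x \<le> p x" "h (a j) = p (a j)"
      using hahn_banach_real [OF vs p] by metis
    have "- h x \<le> p x" for x
      using h(2) [of "- 1" x] h(3) [of "- x"] even [of x] by simp
    with h show ?thesis by (intro exI [of _ h]) (auto simp: abs_le_iff)
  qed
  then obtain h where h_add: "h j (x + y) = h j x + h j y" and h_hom: "h j (s r x) = r * h j x"
    and h_le: "\<bar>h j x\<bar> \<le> p x" and h_a: "h j (a j) = p (a j)" for j x y r by metis
  \<comment> \<open>The value at zero must be nonzero, so that the new term counts even when the
    previous partial sum vanishes at \<open>a j\<close>.\<close>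
  define sg :: "real \<Rightarrow> real" where "sg t = (if 0 \<le> t then 1 else - 1)" for t
  define F where "F = rec_nat (\<lambda>_. 0) (\<lambda>j f x. f x + sg (f (a j)) / 4 ^ j * h j x)"
  have F0: "F 0 x = 0" and FS: "F (Suc j) x = F j x + sg (F j (a j)) / 4 ^ j * h j x" for j x
    by (simp_all add: F_def)
  have step: "\<bar>F (Suc j) x - F j x\<bar> \<le> p x / 4 ^ j" for j x
    using h_le [of j x] by (simp add: FS sg_def abs_mult divide_right_mono)
  have tele: "\<bar>F (j + k) x - F j x\<bar> \<le> (4 / 3) * p x / 4 ^ j * (1 - 1 / 4 ^ k)" for j k x
  proof (induction k)
    case (Suc k)
    have "\<bar>F (j + Suc k) x - F j x\<bar> \<le> (4 / 3) * p x / 4 ^ j * (1 - 1 / 4 ^ k) + p x / 4 ^ (j + k)"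
      using Suc step [of "j + k" x] by simp
    also have "\<dots> = (4 / 3) * p x / 4 ^ j * (1 - 1 / 4 ^ Suc k)"
      by (simp add: power_add field_simps)
    finally show ?case .
  qed simp
  have dist: "\<bar>F (j + k) x - F j x\<bar> \<le> (4 / 3) * p x / 4 ^ j" for j k x
  proof -
    have "(4 / 3) * p x / 4 ^ j * (1 - 1 / 4 ^ k) \<le> (4 / 3) * p x / 4 ^ j * 1"
      using p_nonneg by (intro mult_left_mono) auto
    with tele [of j k x] show ?thesis by linarith
  qed
  have "convergent (\<lambda>n. F n x)" for x
  proof -
    have "summable (\<lambda>n. F (Suc n) x - F n x)"
    proof (rule summable_comparison_test')
      show "summable (\<lambda>n. p x * (1 / 4) ^ n)"
        by (intro summable_mult summable_geometric) simp
      show "norm (F (Suc n) x - F n x) \<le> p x * (1 / 4) ^ n" if "0 \<le> n" for n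
        using step [of n x] by (simp add: power_one_over)
    qed
    moreover have "(\<Sum>i<n. F (Suc i) x - F i x) = F n x" for n
      by (induction n) (simp_all add: F0)
    ultimately show ?thesis
      by (simp add: summable_iff_convergent)
  qed
  then obtain G where G: "(\<lambda>n. F n x) \<longlonglongrightarrow> G x" for x
    unfolding convergent_def by metis
  have G_dist: "\<bar>G x - F j x\<bar> \<le> (4 / 3) * p x / 4 ^ j" for j x
  proof (rule LIMSEQ_le_const2)
    show "(\<lambda>k. \<bar>F (k + j) x - F j x\<bar>) \<longlonglongrightarrow> \<bar>G x - F j x\<bar>"
      by (intro tendsto_intros LIMSEQ_ignore_initial_segment G)
    show "\<exists>N. \<forall>n\<ge>N. \<bar>F (n + j) x - F j x\<bar> \<le> (4 / 3) * p x / 4 ^ j"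
      using dist [of j] by (simp add: add.commute)
  qed
  show thesis
  proof (rule that)
    have "F n (x + y) = F n x + F n y" for n x y
      by (induction n) (auto simp: F0 FS h_add add_divide_distrib algebra_simps)
    then show "G (x + y) = G x + G y" for x y
      using LIMSEQ_unique [OF G [of "x + y"]] tendsto_add [OF G [of x] G [of y]] by simp
    have "F n (s r x) = r * F n x" for n r x
      by (induction n) (auto simp: F0 FS h_hom algebra_simps)
    then show "G (s r x) = r * G x" for r x
      using LIMSEQ_unique [OF G [of "s r x"]] tendsto_mult_left [OF G [of x]] by simp
    show "\<bar>G x\<bar> \<le> 2 * p x" for x
      using G_dist [of x 0] p_nonneg [of x] by (simp add: F0)
    show "\<exists>a\<in>A. K < \<bar>G a\<bar>" for K
    proof -
      obtain j :: nat where j: "2 * \<bar>K\<bar> < j" using reals_Archimedean2 by blast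
      define d where "d = p (a j) / 4 ^ j"
      have "real j < d" using a(2) [of j] by (simp add: d_def field_simps)
      have "F (Suc j) (a j) = F j (a j) + sg (F j (a j)) * d"
        by (simp add: FS h_a d_def)
      then have "d \<le> \<bar>F (Suc j) (a j)\<bar>"
        using \<open>real j < d\<close> by (auto simp: sg_def)
      \<comment> \<open>The tail after the \<open>j\<close>-th term is at most
        \<open>(4 / 3) * (1 / 4) = 1 / 3\<close> of that term, which explains the ratio 4: at least
        \<open>2 * d / 3\<close> survives in the limit.\<close>
      moreover have "\<bar>G (a j) - F (Suc j) (a j)\<bar> \<le> d / 3"
        using G_dist [of "a j" "Suc j"] by (simp add: d_def)
      ultimately have "K < \<bar>G (a j)\<bar>"
        using j \<open>real j < d\<close> by linarith
      with a(1) show ?thesis by blast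
    qed
  qed
qed

section \<open>From real functionals to scalar-valued ones\<close>

lemma vector_space_real_restriction:
  assumes "vector_space (smul :: 'k::real_normed_field \<Rightarrow> 'v::ab_group_add \<Rightarrow> 'v)"
  shows "vector_space (\<lambda>r. smul (of_real r))"
proof -
  interpret vector_space smul by fact
  show ?thesis
    by unfold_locales (simp_all add: scale_right_distrib scale_left_distrib)
qed

text \<open>The real functional is used directly when all scalars are real, and otherwise extended
  in the classical way with \<open>j\<close> as imaginary unit. Domination and unboundedness pass to
  the extension because its norm is comparable with \<open>g\<close>.\<close>

lemma unbounded_linear_functional:
  fixes smul :: "'k::real_normed_field \<Rightarrow> 'v::ab_group_add \<Rightarrow> 'v" and p :: "'v \<Rightarrow> real"
  assumes vs: "vector_space smul"
    and add: "\<And>x y. p (x + y) \<le> p x + p y" and hom: "\<And>a x. p (smul a x) = norm a * p x"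
    and unbdd: "\<And>K. \<exists>a\<in>A. K < p a"
  obtains f C where "linear_functional smul f" and "\<And>x. norm (f x) \<le> C * p x"
    and "\<And>K. \<exists>a\<in>A. K < norm (f a)"
proof -
  interpret vector_space smul by fact
  obtain g where g_add: "\<And>x y. g (x + y) = g x + g y"
    and g_hom: "\<And>r x. g (smul (of_real r) x) = r * g x"
    and g_le: "\<And>x. \<bar>g x\<bar> \<le> 2 * p x" and g_unbdd: "\<And>K. \<exists>a\<in>A. K < \<bar>g a\<bar>"
    using unbounded_linear_functional_real [OF vector_space_real_restriction [OF vs] add _ unbdd] hom
    by (metis norm_of_real)
  show thesis
  proof (cases rule: real_normed_field_cases [where 'a = 'k])
    case 1
    have "g (smul a x) = r * g x" if "a = of_real r" for a r x
      using that g_hom by simp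
    then have "linear_functional smul (\<lambda>x. of_real (g x))"
      unfolding linear_functional_def using g_add 1 by (metis of_real_add of_real_mult)
    then show thesis
      using g_le g_unbdd by (intro that [of "\<lambda>x. of_real (g x)" 2]) auto
  next
    case (2 j)
    define f where "f x = of_real (g x) - j * of_real (g (smul j x))" for x
    have jj: "j * j = - 1" using 2(1) by (simp add: power2_eq_square)
    have "norm j * norm j = 1"
      using jj by (metis norm_minus_cancel norm_mult norm_one)
    then have norm_j: "norm j = 1"
      by (metis abs_norm_cancel abs_square_eq_1 power2_eq_square)
    have f_add: "f (x + y) = f x + f y" for x y
      by (simp add: f_def g_add scale_right_distrib algebra_simps)
    have f_real: "f (smul (of_real r) x) = of_real r * f x" for r x
    proof -
      have "g (smul j (smul (of_real r) x)) = r * g (smul j x)"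
        by (metis g_hom scale_left_commute)
      then show ?thesis
        unfolding f_def g_hom by (simp add: algebra_simps)
    qed
    have g_neg: "g (- x) = - g x" for x
      using g_hom [of "- 1" x] by simp
    have f_j: "f (smul j x) = j * f x" for x
    proof -
      have "smul j (smul j x) = - x" using jj by simp
      moreover have "j * (j * c) = - c" for c
        using jj by (metis mult.assoc mult_minus_left mult_1)
      ultimately show ?thesis by (simp add: f_def g_neg right_diff_distrib)
    qed
    have "f (smul a x) = a * f x" for a x
    proof -
      obtain s t where "a = of_real s + of_real t * j" using 2(2) by blast
      moreover have "f (smul (of_real t * j) x) = of_real t * (j * f x)"
        using f_real f_j by (metis scale_scale)
      ultimately show ?thesis
        by (simp add: scale_left_distrib f_add f_real algebra_simps)
    qed
    with f_add have lin: "linear_functional smul f"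
      by (simp add: linear_functional_def)
    have f_le: "norm (f x) \<le> 4 * p x" for x
    proof -
      have "norm (f x) \<le> \<bar>g x\<bar> + \<bar>g (smul j x)\<bar>"
        unfolding f_def by (rule order_trans [OF norm_triangle_ineq4]) (simp add: norm_mult norm_j)
      also have "\<dots> \<le> 2 * p x + 2 * p x"
        using g_le [of x] g_le [of "smul j x"] by (simp add: hom norm_j)
      finally show ?thesis by simp
    qed
    \<comment> \<open>The norm of the field has not been identified with the complex modulus, so the
      real part is recovered from \<open>(s - j * t) * (s + j * t) = s^2 + t^2\<close> and
      multiplicativity.\<close>
    have lower: "\<bar>g x\<bar> \<le> 2 * norm (f x)" for x
    proof -
      define s t where "s = g x" and "t = g (smul j x)"
      have "(of_real s - j * of_real t) * (of_real s + j * of_real t) =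
          of_real s * of_real s - (j * j) * (of_real t * of_real t)"
        by (simp add: algebra_simps)
      also have "\<dots> = (of_real (s * s + t * t) :: 'k)"
        by (simp add: jj)
      finally have "norm (f x) * norm (of_real s + j * of_real t) = norm (of_real (s * s + t * t) :: 'k)"
        by (metis f_def norm_mult s_def t_def)
      then have eq: "norm (f x) * norm (of_real s + j * of_real t) = s * s + t * t"
        by (simp del: of_real_add of_real_mult)
      have "norm (of_real s + j * of_real t) \<le> \<bar>s\<bar> + \<bar>t\<bar>"
        by (rule order_trans [OF norm_triangle_ineq]) (simp add: norm_mult norm_j)
      then have 1: "s * s + t * t \<le> norm (f x) * (\<bar>s\<bar> + \<bar>t\<bar>)"
        using eq by (metis mult_left_mono norm_ge_zero)
      have "(\<bar>s\<bar> + \<bar>t\<bar>) * (\<bar>s\<bar> + \<bar>t\<bar>) \<le> 2 * (s * s + t * t)"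
      proof -
        have "0 \<le> (\<bar>s\<bar> - \<bar>t\<bar>) * (\<bar>s\<bar> - \<bar>t\<bar>)" by simp
        then show ?thesis by (simp add: algebra_simps)
      qed
      also have "\<dots> \<le> 2 * (norm (f x) * (\<bar>s\<bar> + \<bar>t\<bar>))"
        using 1 by (rule mult_left_mono) simp
      finally have "(\<bar>s\<bar> + \<bar>t\<bar>) * (\<bar>s\<bar> + \<bar>t\<bar>) \<le> (2 * norm (f x)) * (\<bar>s\<bar> + \<bar>t\<bar>)"
        by (simp only: mult.assoc)
      then have "\<bar>s\<bar> + \<bar>t\<bar> \<le> 2 * norm (f x)"
      proof (cases "0 < \<bar>s\<bar> + \<bar>t\<bar>")
        case False
        then show ?thesis using norm_ge_zero [of "f x"] by linarith
      qed (rule mult_right_le_imp_le)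
      then show ?thesis by (simp add: s_def)
    qed
    have "\<exists>a\<in>A. K < norm (f a)" for K
      using g_unbdd [of "2 * K"] lower by (smt (verit))
    with lin f_le show thesis by (rule that)
  qed
qed

section \<open>Seminorm topologies\<close>

lemma openin_seminorm_topology:
  "openin (seminorm_topology P) U \<longleftrightarrow> (\<forall>x0\<in>U. \<exists>J. J \<subseteq> P \<and> finite J \<and>
      (\<exists>\<epsilon>::real. \<epsilon> > 0 \<and> {x. \<forall>\<rho>\<in>J. \<rho> (x - x0) < ennreal \<epsilon>} \<subseteq> U))"
proof -
  let ?op = "\<lambda>U. \<forall>x0\<in>U. \<exists>J. J \<subseteq> P \<and> finite J \<and>
      (\<exists>\<epsilon>::real. \<epsilon> > 0 \<and> {x. \<forall>\<rho>\<in>J. \<rho> (x - x0) < ennreal \<epsilon>} \<subseteq> U)"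
  have "istopology ?op"
    unfolding istopology_def
  proof (intro conjI allI impI)
    fix S T assume S: "?op S" and T: "?op T"
    show "?op (S \<inter> T)"
    proof
      fix x0 assume "x0 \<in> S \<inter> T"
      then obtain J d K e where J: "J \<subseteq> P" "finite J" "(d::real) > 0"
          "{x. \<forall>\<rho>\<in>J. \<rho> (x - x0) < ennreal d} \<subseteq> S"
        and K: "K \<subseteq> P" "finite K" "(e::real) > 0"
          "{x. \<forall>\<rho>\<in>K. \<rho> (x - x0) < ennreal e} \<subseteq> T"
        using S T by (meson IntD1 IntD2)
      have "ennreal (min d e) \<le> ennreal d" "ennreal (min d e) \<le> ennreal e"
        by (simp_all add: ennreal_leI)
      then have "{x. \<forall>\<rho>\<in>J \<union> K. \<rho> (x - x0) < ennreal (min d e)} \<subseteq> S \<inter> T"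
        using J(4) K(4) by (blast intro: order_less_le_trans)
      moreover have "J \<union> K \<subseteq> P" "finite (J \<union> K)" "min d e > 0"
        using J K by auto
      ultimately show "\<exists>J. J \<subseteq> P \<and> finite J \<and>
          (\<exists>\<epsilon>::real. \<epsilon> > 0 \<and> {x. \<forall>\<rho>\<in>J. \<rho> (x - x0) < ennreal \<epsilon>} \<subseteq> S \<inter> T)"
        by blast
    qed
  next
    fix \<K> assume "\<forall>K\<in>\<K>. ?op K"
    then show "?op (\<Union>\<K>)"
      by (meson Union_iff Union_upper order_trans)
  qed
  then show ?thesis
    by (simp add: seminorm_topology_def)
qed

lemma topspace_seminorm_topology [simp]: "topspace (seminorm_topology P) = UNIV"
proof -
  have "openin (seminorm_topology P) UNIV"
    unfolding openin_seminorm_topology using zero_less_one by blast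
  then show ?thesis
    by (metis openin_subset top.extremum_unique)
qed

lemma openin_seminorm_topology_zero:
  assumes "openin (seminorm_topology P) U" and "0 \<in> U"
  obtains J \<epsilon> where "J \<subseteq> P" and "finite J" and "(\<epsilon>::real) > 0"
    and "\<And>x. (\<And>\<rho>. \<rho> \<in> J \<Longrightarrow> \<rho> x < ennreal \<epsilon>) \<Longrightarrow> x \<in> U"
proof -
  obtain J \<epsilon> where "J \<subseteq> P" "finite J" "(\<epsilon>::real) > 0" "{x. \<forall>\<rho>\<in>J. \<rho> (x - 0) < ennreal \<epsilon>} \<subseteq> U"
    using assms unfolding openin_seminorm_topology by blast
  then show thesis by (intro that [of J \<epsilon>]) auto
qed

text \<open>Continuity of a seminorm for \<open>seminorm_topology P\<close>, tested at the origin on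
  basic neighbourhoods; subadditivity would carry it to other points. The sets \<open>J\<close> are
  exactly the finite subfamilies that define the topology.\<close>

definition continuous_at_zero :: "('v::ab_group_add \<Rightarrow> ennreal) set \<Rightarrow> ('v \<Rightarrow> ennreal) \<Rightarrow> bool" where
  "continuous_at_zero P q \<longleftrightarrow> (\<forall>e::real. e > 0 \<longrightarrow> (\<exists>J. J \<subseteq> P \<and> finite J \<and>
     (\<exists>d::real. d > 0 \<and> (\<forall>x. (\<forall>\<rho>\<in>J. \<rho> x < ennreal d) \<longrightarrow> q x < ennreal e))))"

text \<open>By homogeneity a bound on one basic neighbourhood becomes arbitrarily small on a scaled
  copy of it.\<close>

lemma continuous_at_zeroI:
  fixes smul :: "'k::real_normed_field \<Rightarrow> 'v::ab_group_add \<Rightarrow> 'v"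
  assumes P: "\<And>\<rho>. \<rho> \<in> P \<Longrightarrow> ext_seminorm smul \<rho>" and q: "ext_seminorm smul q"
    and J: "J \<subseteq> P" "finite J" and "\<delta> > 0"
    and bdd: "\<And>x. (\<And>\<rho>. \<rho> \<in> J \<Longrightarrow> \<rho> x < ennreal \<delta>) \<Longrightarrow> q x \<le> ennreal C"
  shows "continuous_at_zero P q"
  unfolding continuous_at_zero_def
proof (intro allI impI)
  fix e :: real assume "e > 0"
  \<comment> \<open>The maximum makes the bound positive, and the factor 2 in \<open>r\<close>
    yields \<open>q x \<le> e / 2\<close>, hence the strict inequality.\<close>
  define D where "D = max C 1"
  define r where "r = 2 * D / e"
  have "D > 0" and "C \<le> D" by (auto simp: D_def)
  have "r > 0" using \<open>D > 0\<close> \<open>e > 0\<close> by (simp add: r_def)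
  have "q x < ennreal e" if x: "\<forall>\<rho>\<in>J. \<rho> x < ennreal (\<delta> / r)" for x
  proof -
    have "\<rho> (smul (of_real r) x) < ennreal \<delta>" if "\<rho> \<in> J" for \<rho>
    proof -
      have "\<rho> (smul (of_real r) x) = ennreal r * \<rho> x"
        using P [of \<rho>] J that \<open>r > 0\<close> by (auto simp: ext_seminorm_def)
      also have "\<dots> < ennreal r * ennreal (\<delta> / r)"
        using x that \<open>r > 0\<close> by (intro ennreal_mult_strict_left_mono) auto
      also have "\<dots> = ennreal \<delta>"
        using \<open>r > 0\<close> \<open>\<delta> > 0\<close> by (simp flip: ennreal_mult)
      finally show ?thesis .
    qed
    then have "q (smul (of_real r) x) \<le> ennreal D"
      using bdd \<open>C \<le> D\<close> by (meson ennreal_leI order_trans)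
    moreover have "q (smul (of_real r) x) = ennreal r * q x"
      using q \<open>r > 0\<close> by (simp add: ext_seminorm_def)
    ultimately have le: "ennreal r * q x \<le> ennreal D" by simp
    show ?thesis
    proof (rule ccontr)
      assume "\<not> q x < ennreal e"
      then have "ennreal r * ennreal e \<le> ennreal r * q x"
        by (intro mult_left_mono) auto
      with le have "ennreal r * ennreal e \<le> ennreal D" by (rule order_trans [rotated])
      then have "r * e \<le> D"
        using \<open>r > 0\<close> \<open>e > 0\<close> \<open>D > 0\<close> by (simp flip: ennreal_mult)
      then show False using \<open>D > 0\<close> \<open>e > 0\<close> by (simp add: r_def)
    qed
  qed
  with J \<open>\<delta> > 0\<close> \<open>r > 0\<close> show "\<exists>J\<subseteq>P. finite J \<and>
      (\<exists>d>0. \<forall>x. (\<forall>\<rho>\<in>J. \<rho> x < ennreal d) \<longrightarrow> q x < ennreal e)"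
    by (intro exI [of _ J] conjI exI [of _ "\<delta> / r"]) auto
qed

lemma coarser_seminorm_topology:
  assumes "\<And>q. q \<in> Q \<Longrightarrow> continuous_at_zero P q"
  shows "coarser (seminorm_topology Q) (seminorm_topology P)"
  unfolding coarser_def
proof (intro allI impI)
  fix U assume U: "openin (seminorm_topology Q) U"
  show "openin (seminorm_topology P) U"
    unfolding openin_seminorm_topology
  proof
    fix x0 assume "x0 \<in> U"
    then obtain J \<epsilon> where J: "J \<subseteq> Q" "finite J" and "(\<epsilon>::real) > 0"
      and sub: "{x. \<forall>q\<in>J. q (x - x0) < ennreal \<epsilon>} \<subseteq> U"
      using U unfolding openin_seminorm_topology by meson
    have "\<forall>q\<in>J. \<exists>K d. K \<subseteq> P \<and> finite K \<and> (d::real) > 0 \<and>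
        (\<forall>x. (\<forall>\<rho>\<in>K. \<rho> x < ennreal d) \<longrightarrow> q x < ennreal \<epsilon>)"
    proof
      fix q assume "q \<in> J"
      then have "continuous_at_zero P q" using assms J(1) by blast
      then show "\<exists>K d. K \<subseteq> P \<and> finite K \<and> (d::real) > 0 \<and>
          (\<forall>x. (\<forall>\<rho>\<in>K. \<rho> x < ennreal d) \<longrightarrow> q x < ennreal \<epsilon>)"
        using \<open>\<epsilon> > 0\<close> unfolding continuous_at_zero_def by meson
    qed
    then obtain K d where K: "\<And>q. q \<in> J \<Longrightarrow> K q \<subseteq> P \<and> finite (K q) \<and> (d q :: real) > 0 \<and>
        (\<forall>x. (\<forall>\<rho>\<in>K q. \<rho> x < ennreal (d q)) \<longrightarrow> q x < ennreal \<epsilon>)"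
      by metis
    \<comment> \<open>The inserted \<open>1\<close> provides a radius when \<open>J\<close> is
      empty.\<close>
    define d' where "d' = Min (insert 1 (d ` J))"
    have "d' > 0" using J K by (auto simp: d'_def)
    have d': "d' \<le> d q" if "q \<in> J" for q
      using that J by (auto simp: d'_def)
    have "{x. \<forall>\<rho>\<in>\<Union> (K ` J). \<rho> (x - x0) < ennreal d'} \<subseteq> U"
    proof
      fix x assume x: "x \<in> {x. \<forall>\<rho>\<in>\<Union> (K ` J). \<rho> (x - x0) < ennreal d'}"
      have "q (x - x0) < ennreal \<epsilon>" if "q \<in> J" for q
      proof -
        have "\<rho> (x - x0) < ennreal (d q)" if "\<rho> \<in> K q" for \<rho>
          using x \<open>q \<in> J\<close> that d' [OF \<open>q \<in> J\<close>] by (auto intro: order_less_le_trans ennreal_leI)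
        then show ?thesis using K [OF that] by blast
      qed
      then show "x \<in> U" using sub by blast
    qed
    moreover have "\<Union> (K ` J) \<subseteq> P" "finite (\<Union> (K ` J))"
      using J K by auto
    ultimately show "\<exists>J. J \<subseteq> P \<and> finite J \<and>
        (\<exists>\<epsilon>::real. \<epsilon> > 0 \<and> {x. \<forall>\<rho>\<in>J. \<rho> (x - x0) < ennreal \<epsilon>} \<subseteq> U)"
      using \<open>d' > 0\<close> by blast
  qed
qed

section \<open>Continuous linear functionals\<close>

lemma linear_functional_diff:
  "linear_functional smul f \<Longrightarrow> f (x - y) = f x - f y"
  unfolding linear_functional_def by (metis add_diff_cancel diff_add_cancel)

lemma linear_functional_zero:
  "linear_functional smul f \<Longrightarrow> f 0 = 0"
  using linear_functional_diff [of smul f 0 0] by simp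

lemma ext_seminorm_norm_functional:
  assumes "linear_functional smul f"
  shows "ext_seminorm smul (\<lambda>x. ennreal (norm (f x)))"
  using assms
  by (auto simp: linear_functional_def ext_seminorm_def norm_mult ennreal_mult norm_triangle_ineq
      simp flip: ennreal_plus intro!: ennreal_leI)

lemma continuous_map_seminorm_topology:
  assumes f: "linear_functional smul f"
    and cont: "continuous_at_zero P (\<lambda>x. ennreal (norm (f x)))"
  shows "continuous_map (seminorm_topology P) euclidean f"
proof -
  have "openin (seminorm_topology P) {x. f x \<in> S}" if "open S" for S
    unfolding openin_seminorm_topology
  proof
    fix x0 assume "x0 \<in> {x. f x \<in> S}"
    then obtain e where "e > 0" and e: "\<And>y. dist y (f x0) < e \<Longrightarrow> y \<in> S"
      using \<open>open S\<close> unfolding open_dist by blast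
    obtain J d where J: "J \<subseteq> P" "finite J" "(d::real) > 0"
      and small: "\<And>x. (\<forall>\<rho>\<in>J. \<rho> x < ennreal d) \<Longrightarrow> ennreal (norm (f x)) < ennreal e"
      using cont \<open>e > 0\<close> unfolding continuous_at_zero_def by meson
    have "{x. \<forall>\<rho>\<in>J. \<rho> (x - x0) < ennreal d} \<subseteq> {x. f x \<in> S}"
    proof clarify
      fix x assume "\<forall>\<rho>\<in>J. \<rho> (x - x0) < ennreal d"
      then have "norm (f (x - x0)) < e"
        using small by (simp add: ennreal_less_iff)
      then show "f x \<in> S"
        using e by (simp add: dist_norm linear_functional_diff [OF f])
    qed
    with J show "\<exists>J. J \<subseteq> P \<and> finite J \<and>
        (\<exists>\<epsilon>::real. \<epsilon> > 0 \<and> {x. \<forall>\<rho>\<in>J. \<rho> (x - x0) < ennreal \<epsilon>} \<subseteq> {x. f x \<in> S})"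
      by blast
  qed
  then show ?thesis
    by (simp add: continuous_map_def)
qed

lemma continuous_functional_near_zero:
  assumes "f \<in> dual_space smul (seminorm_topology P)"
  shows "openin (seminorm_topology P) {x. norm (f x) < 1}" and "0 \<in> {x. norm (f x) < 1}"
proof -
  have f: "linear_functional smul f" "continuous_map (seminorm_topology P) euclidean f"
    using assms by (auto simp: dual_space_def)
  have "openin (seminorm_topology P) {x \<in> topspace (seminorm_topology P). f x \<in> ball 0 1}"
    using f(2) by (rule openin_continuous_map_preimage) simp
  then show "openin (seminorm_topology P) {x. norm (f x) < 1}" by simp
  show "0 \<in> {x. norm (f x) < 1}" using linear_functional_zero [OF f(1)] by simp
qed

lemma dual_space_dominated:
  fixes smul :: "'k::real_normed_field \<Rightarrow> 'v::ab_group_add \<Rightarrow> 'v"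
  assumes P: "\<And>\<rho>. \<rho> \<in> P \<Longrightarrow> ext_seminorm smul \<rho>" and f: "linear_functional smul f"
    and p: "(\<lambda>x. ennreal (p x)) \<in> P" and p_nonneg: "\<And>x. 0 \<le> p x" and le: "\<And>x. norm (f x) \<le> C * p x"
  shows "f \<in> dual_space smul (seminorm_topology P)"
proof -
  have "continuous_at_zero P (\<lambda>x. ennreal (norm (f x)))"
  proof (rule continuous_at_zeroI [OF P ext_seminorm_norm_functional [OF f]])
    show "{\<lambda>x. ennreal (p x)} \<subseteq> P" using p by simp
    fix x assume "\<And>\<rho>. \<rho> \<in> {\<lambda>x. ennreal (p x)} \<Longrightarrow> \<rho> x < ennreal 1"
    then have "p x < 1"
      using p_nonneg [of x] by (simp add: ennreal_less_one_iff)
    have "norm (f x) \<le> \<bar>C\<bar> * p x"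
      using le [of x] p_nonneg [of x] by (meson abs_ge_self mult_right_mono order_trans)
    also have "\<dots> \<le> \<bar>C\<bar> * 1"
      using \<open>p x < 1\<close> by (intro mult_left_mono) auto
    finally have "norm (f x) \<le> \<bar>C\<bar>" by simp
    then show "ennreal (norm (f x)) \<le> ennreal \<bar>C\<bar>" by (simp add: ennreal_leI)
  qed auto
  with f show ?thesis
    by (simp add: dual_space_def continuous_map_seminorm_topology)
qed

section \<open>Comparing the norm with \<tau> and its finest locally convex topology\<close>

lemma is_norm_imp_finite_seminorm:
  assumes "is_norm smul N"
  shows "finite_seminorm smul (\<lambda>x. ennreal (N x))"
  using assms
  by (auto simp: is_norm_def finite_seminorm_def ext_seminorm_def ennreal_mult
      simp flip: ennreal_plus intro!: ennreal_leI)

text \<open>Otherwise some sequence that tends to zero in \<open>\<tau>\<close> is unbounded in norm, and a norm-continuous functional that is unbounded along it contradicts the equality of the duals.\<close>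
lemma norm_continuous_at_zero:
  fixes smul :: "'k::real_normed_field \<Rightarrow> 'v::ab_group_add \<Rightarrow> 'v"
  assumes vs: "vector_space smul" and P: "\<And>\<rho>. \<rho> \<in> P \<Longrightarrow> ext_seminorm smul \<rho>"
    and base: "countable_nhds_base_at (seminorm_topology P) 0" and N: "is_norm smul N"
    and dual: "dual_space smul (norm_topology N) \<subseteq> dual_space smul (seminorm_topology P)"
  shows "continuous_at_zero P (\<lambda>x. ennreal (N x))"
proof -
  let ?N = "\<lambda>x. ennreal (N x)"
  have N_semi: "ext_seminorm smul ?N"
    using is_norm_imp_finite_seminorm [OF N] by (simp add: finite_seminorm_def)
  have N_nonneg: "0 \<le> N x" and N_add: "N (x + y) \<le> N x + N y"
    and N_hom: "N (smul a x) = norm a * N x" for x y a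
    using N unfolding is_norm_def by blast+
  obtain B where "countable B"
    and B_nhd: "\<And>V. V \<in> B \<Longrightarrow> \<exists>W. openin (seminorm_topology P) W \<and> 0 \<in> W \<and> W \<subseteq> V"
    and B_base: "\<And>U. openin (seminorm_topology P) U \<Longrightarrow> 0 \<in> U \<Longrightarrow> \<exists>V\<in>B. V \<subseteq> U"
  proof -
    obtain B where "countable B"
      and "\<forall>V\<in>B. \<exists>W. openin (seminorm_topology P) W \<and> 0 \<in> W \<and> W \<subseteq> V"
      and "\<forall>U. openin (seminorm_topology P) U \<and> 0 \<in> U \<longrightarrow> (\<exists>V\<in>B. V \<subseteq> U)"
      using base unfolding countable_nhds_base_at_def by (elim exE conjE) (rule that)
    then show thesis by (intro that [of B]) simp_all
  qed
  have "B \<noteq> {}"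
    using B_base [of UNIV] openin_topspace [of "seminorm_topology P"] by auto
  \<comment> \<open>A finite base is enumerated with repetitions, so every natural number is an
    index.\<close>
  define V where "V = from_nat_into B"
  have "V n \<in> B" for n
    using \<open>B \<noteq> {}\<close> by (simp add: V_def from_nat_into)
  have "\<exists>J \<epsilon>. J \<subseteq> P \<and> finite J \<and> (\<epsilon>::real) > 0 \<and> (\<forall>x. (\<forall>\<rho>\<in>J. \<rho> x < ennreal \<epsilon>) \<longrightarrow> x \<in> V n)" for n
  proof -
    obtain W where "openin (seminorm_topology P) W" "0 \<in> W" "W \<subseteq> V n"
      using B_nhd [OF \<open>V n \<in> B\<close>] by blast
    then show ?thesis
      using openin_seminorm_topology_zero [of P W] by (metis subsetD)
  qed
  then obtain J \<epsilon> where J: "\<And>n. J n \<subseteq> P" "\<And>n. finite (J n)" "\<And>n::nat. (\<epsilon> n :: real) > 0"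
    and JV: "\<And>n x. (\<And>\<rho>. \<rho> \<in> J n \<Longrightarrow> \<rho> x < ennreal (\<epsilon> n)) \<Longrightarrow> x \<in> V n"
    by metis
  show ?thesis
  proof (rule ccontr)
    assume not_cont: "\<not> ?thesis"
    \<comment> \<open>The \<open>V m\<close> need not decrease, so the \<open>n\<close>-th point is
      taken in all of the sets up to \<open>n\<close>. A bound \<open>n\<close> for the norm on
      their intersection would already make it continuous, by homogeneity.\<close>
    have "\<exists>x. real n < N x \<and> (\<forall>m\<le>n. x \<in> V m)" for n
    proof -
      define \<delta> where "\<delta> = Min (\<epsilon> ` {..n})"
      have "\<delta> > 0" using J(3) by (simp add: \<delta>_def)
      have \<delta>: "\<delta> \<le> \<epsilon> m" if "m \<le> n" for m using that by (simp add: \<delta>_def)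
      have "\<exists>x. (\<forall>\<rho>\<in>(\<Union>m\<le>n. J m). \<rho> x < ennreal \<delta>) \<and> \<not> ?N x \<le> ennreal n"
      proof (rule ccontr)
        assume "\<nexists>x. (\<forall>\<rho>\<in>(\<Union>m\<le>n. J m). \<rho> x < ennreal \<delta>) \<and> \<not> ?N x \<le> ennreal n"
        then have "?N x \<le> ennreal n" if "\<And>\<rho>. \<rho> \<in> (\<Union>m\<le>n. J m) \<Longrightarrow> \<rho> x < ennreal \<delta>" for x
          using that by blast
        moreover have "(\<Union>m\<le>n. J m) \<subseteq> P" "finite (\<Union>m\<le>n. J m)" using J by auto
        ultimately have "continuous_at_zero P ?N"
          using continuous_at_zeroI [of P smul ?N "\<Union>m\<le>n. J m" \<delta> "real n"] P N_semi \<open>\<delta> > 0\<close>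
          by blast
        with not_cont show False by simp
      qed
      then obtain x where x: "\<And>\<rho> m. m \<le> n \<Longrightarrow> \<rho> \<in> J m \<Longrightarrow> \<rho> x < ennreal \<delta>"
        and "\<not> ?N x \<le> ennreal n" by blast
      then have "real n < N x"
        using N_nonneg by (simp add: ennreal_le_iff2 not_le)
      moreover have "x \<in> V m" if "m \<le> n" for m
        using x [OF that] \<delta> [OF that] by (intro JV) (meson ennreal_leI order_less_le_trans)
      ultimately show ?thesis by blast
    qed
    then obtain x where N_x: "\<And>n. real n < N (x n)" and V_x: "\<And>n m. m \<le> n \<Longrightarrow> x n \<in> V m"
      by metis
    have "\<exists>a\<in>range x. K < N a" for K
    proof -
      obtain n :: nat where "K < n" using reals_Archimedean2 by blast
      then show ?thesis using N_x [of n] by (meson order_less_trans rangeI)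
    qed
    then obtain f C where f: "linear_functional smul f" and f_le: "\<And>x. norm (f x) \<le> C * N x"
      and f_unbdd: "\<And>K. \<exists>a\<in>range x. K < norm (f a)"
      using unbounded_linear_functional [where p = N and A = "range x", OF vs N_add N_hom] by metis
    have "f \<in> dual_space smul (norm_topology N)"
      unfolding norm_topology_def
      using N_semi N_nonneg f_le by (intro dual_space_dominated [OF _ f]) auto
    then have f_dual: "f \<in> dual_space smul (seminorm_topology P)" using dual by blast
    obtain m where m: "V m \<subseteq> {x. norm (f x) < 1}"
    proof -
      obtain W where "W \<in> B" "W \<subseteq> {x. norm (f x) < 1}"
        using B_base continuous_functional_near_zero [OF f_dual] by blast
      then show thesis
        using that from_nat_into_surj [OF \<open>countable B\<close>] unfolding V_def by metis
    qed
    \<comment> \<open>Finitely many terms lie outside the control of \<open>V m\<close>; the value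
      \<open>1\<close> covers all later ones.\<close>
    define K where "K = Max (insert 1 ((\<lambda>n. norm (f (x n))) ` {..m}))"
    have "norm (f (x n)) \<le> K" for n
    proof (cases "n \<le> m")
      case True
      then show ?thesis
        unfolding K_def by (intro Max_ge) auto
    next
      case False
      then have "norm (f (x n)) < 1" using V_x [of m n] m by auto
      moreover have "1 \<le> K" by (simp add: K_def)
      ultimately show ?thesis by linarith
    qed
    with f_unbdd [of K] show False by (auto simp: not_less [symmetric])
  qed
qed

text \<open>Finite values turn \<open>q\<close> into a real seminorm \<open>p\<close>. If
  \<open>p\<close> were unbounded on the unit ball, so would be some functional dominated by a
  multiple of \<open>p\<close>; it is continuous for \<open>Q\<close>, hence for the norm, hence
  bounded on the ball.\<close>

lemma finite_seminorm_norm_continuous: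
  fixes smul :: "'k::real_normed_field \<Rightarrow> 'v::ab_group_add \<Rightarrow> 'v"
  assumes vs: "vector_space smul" and Q: "\<And>\<rho>. \<rho> \<in> Q \<Longrightarrow> finite_seminorm smul \<rho>"
    and q: "q \<in> Q" and N: "is_norm smul N"
    and dual: "dual_space smul (seminorm_topology Q) \<subseteq> dual_space smul (norm_topology N)"
  shows "continuous_at_zero {\<lambda>x. ennreal (N x)} q"
proof -
  interpret vector_space smul by fact
  let ?N = "\<lambda>x. ennreal (N x)"
  define p where "p x = enn2real (q x)" for x
  have Q_semi: "ext_seminorm smul \<rho>" if "\<rho> \<in> Q" for \<rho>
    using Q that by (simp add: finite_seminorm_def)
  have q_eq: "q x = ennreal (p x)" for x
    using Q [OF q] by (simp add: p_def finite_seminorm_def less_top)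
  have p_nonneg: "0 \<le> p x" for x by (simp add: p_def)
  have p_hom: "p (smul a x) = norm a * p x" for a x
    using Q_semi [OF q] by (simp add: p_def ext_seminorm_def enn2real_mult)
  have p_add: "p (x + y) \<le> p x + p y" for x y
  proof -
    have "ennreal (p (x + y)) \<le> ennreal (p x + p y)"
      using Q_semi [OF q] p_nonneg by (simp add: ext_seminorm_def flip: q_eq)
    then show ?thesis
      by (metis add_nonneg_nonneg ennreal_le_iff p_nonneg)
  qed
  have N_hom: "N (smul a x) = norm a * N x" and N_nonneg: "0 \<le> N x" for a x
    using N unfolding is_norm_def by blast+
  have N_semi: "ext_seminorm smul ?N"
    using is_norm_imp_finite_seminorm [OF N] by (simp add: finite_seminorm_def)
  have "\<exists>K. \<forall>x\<in>{x. N x < 1}. p x \<le> K"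
  proof (rule ccontr)
    assume "\<nexists>K. \<forall>x\<in>{x. N x < 1}. p x \<le> K"
    then have "\<exists>a\<in>{x. N x < 1}. K < p a" for K by (meson not_le)
    then obtain f C where f: "linear_functional smul f" and f_le: "\<And>x. norm (f x) \<le> C * p x"
      and f_unbdd: "\<And>K. \<exists>a\<in>{x. N x < 1}. K < norm (f a)"
      using unbounded_linear_functional [where p = p and A = "{x. N x < 1}", OF vs p_add p_hom]
      by metis
    have "(\<lambda>x. ennreal (p x)) \<in> Q" using q by (simp flip: q_eq)
    then have "f \<in> dual_space smul (norm_topology N)"
      using dual_space_dominated [OF Q_semi f _ p_nonneg f_le] dual by blast
    then obtain J \<epsilon> where J: "J \<subseteq> {?N}" "(\<epsilon>::real) > 0"
      and small: "\<And>x. (\<And>\<rho>. \<rho> \<in> J \<Longrightarrow> \<rho> x < ennreal \<epsilon>) \<Longrightarrow> norm (f x) < 1"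
      using openin_seminorm_topology_zero [of "{?N}" "{x. norm (f x) < 1}"]
        continuous_functional_near_zero [of f smul "{?N}"]
      unfolding norm_topology_def by (metis mem_Collect_eq)
    have "norm (f x) \<le> 1 / \<epsilon>" if "N x < 1" for x
    proof -
      have "N (smul (of_real \<epsilon>) x) < \<epsilon>"
        using that \<open>\<epsilon> > 0\<close> by (simp add: N_hom)
      then have "norm (f (smul (of_real \<epsilon>) x)) < 1"
        using J N_nonneg by (intro small) (auto simp: ennreal_less_iff)
      moreover have "f (smul (of_real \<epsilon>) x) = of_real \<epsilon> * f x"
        using f by (simp add: linear_functional_def)
      ultimately show ?thesis
        using \<open>\<epsilon> > 0\<close> by (simp add: norm_mult field_simps)
    qed
    with f_unbdd [of "1 / \<epsilon>"] show False by (auto simp: not_less [symmetric])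
  qed
  then obtain K where K: "\<And>x. N x < 1 \<Longrightarrow> p x \<le> K" by blast
  show ?thesis
  proof (rule continuous_at_zeroI [OF _ Q_semi [OF q] subset_refl])
    show "q x \<le> ennreal K" if "\<And>\<rho>. \<rho> \<in> {?N} \<Longrightarrow> \<rho> x < ennreal 1" for x
      using that [of ?N] K [of x] N_nonneg [of x]
      by (simp add: q_eq ennreal_leI ennreal_less_one_iff)
  qed (simp_all add: N_semi)
qed

theorem theorem5p16:
  fixes smul :: "'k::real_normed_field \<Rightarrow> 'v::ab_group_add \<Rightarrow> 'v"
    and \<tau> \<tau>F :: "'v topology" and N :: "'v \<Rightarrow> real"
  assumes "vector_space smul"
    and "ext_lc_topology smul \<tau>"
    and "Hausdorff_space \<tau>"
    and "countable_nhds_base_at \<tau> 0"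
    and "finest_lc_topology smul \<tau> \<tau>F"
    and "is_norm smul N"
    and "dual_space smul (norm_topology N) = dual_space smul \<tau>"
  shows "\<tau>F = norm_topology N"
proof -
  let ?N = "\<lambda>x. ennreal (N x)"
  obtain P where P: "\<And>\<rho>. \<rho> \<in> P \<Longrightarrow> ext_seminorm smul \<rho>" and \<tau>: "\<tau> = seminorm_topology P"
    using assms(2) unfolding ext_lc_topology_def by blast
  obtain Q where Q: "\<And>\<rho>. \<rho> \<in> Q \<Longrightarrow> finite_seminorm smul \<rho>" and \<tau>F: "\<tau>F = seminorm_topology Q"
    using assms(5) unfolding finest_lc_topology_def lc_topology_def by blast
  have \<tau>F_\<tau>: "coarser \<tau>F \<tau>"
    and finest: "\<And>\<sigma>. lc_topology smul \<sigma> \<Longrightarrow> coarser \<sigma> \<tau> \<Longrightarrow> coarser \<sigma> \<tau>F"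
    using assms(5) unfolding finest_lc_topology_def by auto
  \<comment> \<open>This puts the norm topology among the locally convex topologies coarser than
    \<open>\<tau>\<close>, over which \<open>\<tau>F\<close> is the finest.\<close>
  have "continuous_at_zero P ?N"
    using norm_continuous_at_zero [OF assms(1) P] assms(4,6,7) unfolding \<tau> by blast
  then have "coarser (norm_topology N) \<tau>"
    unfolding norm_topology_def \<tau> by (intro coarser_seminorm_topology) auto
  moreover have "lc_topology smul (norm_topology N)"
    unfolding lc_topology_def norm_topology_def
    using is_norm_imp_finite_seminorm [OF assms(6)] by (intro exI [of _ "{?N}"]) auto
  ultimately have 1: "coarser (norm_topology N) \<tau>F"
    by (intro finest)
  \<comment> \<open>A functional continuous for the coarser \<open>\<tau>F\<close> is
    \<open>\<tau>\<close>-continuous and therefore norm-continuous by the equality of duals.\<close>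
  have "continuous_map \<tau> euclidean f" if "continuous_map \<tau>F euclidean f" for f :: "'v \<Rightarrow> 'k"
    using that \<tau>F_\<tau> by (auto simp: continuous_map_def coarser_def \<tau> \<tau>F)
  then have dual: "dual_space smul \<tau>F \<subseteq> dual_space smul (norm_topology N)"
    unfolding assms(7) by (auto simp: dual_space_def)
  have "continuous_at_zero {?N} q" if "q \<in> Q" for q
    by (rule finite_seminorm_norm_continuous [OF assms(1) _ that assms(6) dual [unfolded \<tau>F]])
      (rule Q)
  then have 2: "coarser \<tau>F (norm_topology N)"
    unfolding norm_topology_def \<tau>F by (rule coarser_seminorm_topology)
  show ?thesis
    using 1 2 by (auto simp: coarser_def topology_eq)
qed

end
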